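(* For every even integer $k \geq 4$ and every odd integer $t \geq 3$, the graph $K_{k+1} \times K_t$ has a partial $C_{kt}$-factorization.
   Context: For graphs $G,H$, the tensor product $G \times H$ has vertex set $V(G)\times V(H)$, with $(g_1,h_1)$ adjacent to $(g_2,h_2)$ iff $g_1g_2 \in E(G)$ and $h_1h_2 \in E(H)$. $K_n$ is the complete graph on $n$ vertices. $K_{u} \times K_t$ is regarded as a $u$-partite graph with partite sets $V_i = \{i\}\times V(K_t)$. A partial $C_m$-factor of $K_u \times K_t$ is a subgraph which, for some $i$, is a spanning subgraph of $(K_u \times K_t)\setminus V_i$ all of whose components are cycles of length $m$; a partial $C_m$-factorization is a partition of the edge set into partial $C_m$-factors. *)

theory Defs
  imports Main "HOL-Library.Disjoint_Sets"
begin

record 'a graph =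
  verts :: "'a set"
  edges :: "'a set set"

definition simple_graph :: "'a graph \<Rightarrow> bool" where
  "simple_graph G \<longleftrightarrow>
     (\<forall>e \<in> edges G. \<exists>x y. x \<in> verts G \<and> y \<in> verts G \<and> x \<noteq> y \<and> e = {x, y})"

definition subgraph :: "'a graph \<Rightarrow> 'a graph \<Rightarrow> bool" where
  "subgraph H G \<longleftrightarrow> simple_graph H \<and> verts H \<subseteq> verts G \<and> edges H \<subseteq> edges G"

definition spanning_subgraph :: "'a graph \<Rightarrow> 'a graph \<Rightarrow> bool" where
  "spanning_subgraph H G \<longleftrightarrow> subgraph H G \<and> verts H = verts G"

definition induced_subgraph :: "'a graph \<Rightarrow> 'a set \<Rightarrow> 'a graph" where
  "induced_subgraph G S = \<lparr>verts = verts G \<inter> S, edges = {e \<in> edges G. e \<subseteq> S}\<rparr>"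

definition delete_verts :: "'a graph \<Rightarrow> 'a set \<Rightarrow> 'a graph" where
  "delete_verts G S = induced_subgraph G (verts G - S)"

definition connected_in :: "'a graph \<Rightarrow> 'a \<Rightarrow> 'a \<Rightarrow> bool" where
  "connected_in G = (\<lambda>x y. {x, y} \<in> edges G)\<^sup>*\<^sup>*"

definition components :: "'a graph \<Rightarrow> 'a graph set" where
  "components G = {induced_subgraph G {y \<in> verts G. connected_in G x y} | x. x \<in> verts G}"

definition cycle_graph :: "nat \<Rightarrow> 'a graph \<Rightarrow> bool" where
  "cycle_graph m C \<longleftrightarrow> m \<ge> 3 \<and>
     (\<exists>vs. length vs = m \<and> distinct vs \<and> verts C = set vs \<and>
           edges C = {{vs ! i, vs ! (Suc i mod m)} | i. i < m})"

definition complete_graph :: "nat \<Rightarrow> nat graph" where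
  "complete_graph n = \<lparr>verts = {..<n}, edges = {{x, y} | x y. x < n \<and> y < n \<and> x \<noteq> y}\<rparr>"

definition tensor_product :: "'a graph \<Rightarrow> 'b graph \<Rightarrow> ('a \<times> 'b) graph" where
  "tensor_product G H =
     \<lparr>verts = verts G \<times> verts H,
      edges = {{(g1, h1), (g2, h2)} | g1 h1 g2 h2.
                 {g1, g2} \<in> edges G \<and> {h1, h2} \<in> edges H}\<rparr>"

definition KK :: "nat \<Rightarrow> nat \<Rightarrow> (nat \<times> nat) graph" where
  "KK u t = tensor_product (complete_graph u) (complete_graph t)"

definition part :: "nat \<Rightarrow> nat \<Rightarrow> (nat \<times> nat) set" where
  "part t i = {i} \<times> verts (complete_graph t)"

definition partial_cycle_factor :: "nat \<Rightarrow> nat \<Rightarrow> nat \<Rightarrow> (nat \<times> nat) graph \<Rightarrow> bool" where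
  "partial_cycle_factor m u t F \<longleftrightarrow>
     (\<exists>i \<in> verts (complete_graph u).
        spanning_subgraph F (delete_verts (KK u t) (part t i)) \<and>
        (\<forall>C \<in> components F. cycle_graph m C))"

definition partial_cycle_factorization ::
    "nat \<Rightarrow> nat \<Rightarrow> nat \<Rightarrow> (nat \<times> nat) graph set \<Rightarrow> bool" where
  "partial_cycle_factorization m u t \<F> \<longleftrightarrow>
     (\<forall>F \<in> \<F>. partial_cycle_factor m u t F) \<and>
     disjoint_family_on edges \<F> \<and>
     (\<Union>F \<in> \<F>. edges F) = edges (KK u t)"

end

theory Submission
  imports Defs
begin

text \<open>
  Write \<open>k = 2r\<close> and \<open>n = k + 1\<close>. On the nonzero residues modulo \<open>n\<close> there is a directed
  \<open>k\<close>-cycle, antipodal in the sense that \<open>vertex (l + r) = - vertex l\<close>, whose steps run through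
  every nonzero residue exactly once; its \<open>n\<close> translates therefore use every arc of the complete
  digraph on \<open>n\<close> vertices once, hence every edge once in each direction.

  For each even \<open>e\<close> with \<open>0 < e < t\<close> lift the cycle to second coordinates modulo \<open>t\<close>, adding \<open>\<plusminus>e\<close>
  along an arc and \<open>\<plusminus>(1 - e)\<close>, with the same sign, along the antipodal arc. Read in a common
  direction, the two lifts of an edge carry the even residues \<open>e\<close> and the odd residues \<open>e - 1\<close>, so
  together they account for every nonzero difference once. An antipodal pair of arcs contributes
  \<open>\<plusminus>1\<close> to the total shift of one turn; with the signs chosen so that the total is 1 or 2, which
  is coprime to the odd number \<open>t\<close>, each lift closes up only after \<open>t\<close> turns and is a single cycle
  of length \<open>kt\<close>.
\<close>

section \<open>Cycles given by closed walks\<close>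

text \<open>The successor index is not reduced modulo \<open>m\<close>: walks with
  \<open>f m = f 0\<close> supply the closing edge themselves.\<close>

definition walk_cycle :: "nat \<Rightarrow> (nat \<Rightarrow> 'a) \<Rightarrow> 'a graph" where
  "walk_cycle m f = \<lparr>verts = f ` {..<m}, edges = {{f l, f (Suc l)} | l. l < m}\<rparr>"

lemma cycle_graph_walk_cycle:
  assumes "m \<ge> 3" "inj_on f {..<m}" "f m = f 0"
  shows "cycle_graph m (walk_cycle m f)"
proof -
  let ?vs = "map f [0..<m]"
  have "{?vs ! i, ?vs ! (Suc i mod m)} = {f i, f (Suc i)}" if "i < m" for i
    using that assms by (cases "Suc i = m") auto
  then have "edges (walk_cycle m f) = {{?vs ! i, ?vs ! (Suc i mod m)} | i. i < m}"
    unfolding walk_cycle_def graph.simps by (intro Collect_cong ex_cong1) metis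
  moreover have "length ?vs = m \<and> distinct ?vs \<and> verts (walk_cycle m f) = set ?vs"
    using assms by (simp add: walk_cycle_def distinct_map atLeast0LessThan)
  ultimately show ?thesis
    using assms(1) unfolding cycle_graph_def by blast
qed

text \<open>Following the list reaches every vertex from \<open>vs ! 0\<close>, and adjacency is
  symmetric, so there is only one connectivity class.\<close>

lemma components_cycle_graph:
  assumes "cycle_graph m C"
  shows "components C = {C}"
proof -
  obtain vs where vs: "length vs = m" "m \<ge> 3" "verts C = set vs"
      "edges C = {{vs ! i, vs ! (Suc i mod m)} | i. i < m}"
    using assms by (auto simp: cycle_graph_def)
  \<comment> \<open>Edges stay inside the vertex set, so the subgraph induced on all vertices is
    \<open>C\<close> itself.\<close>
  have sub: "\<Union>(edges C) \<subseteq> verts C"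
  proof
    fix x assume "x \<in> \<Union>(edges C)"
    then obtain i where i: "i < m" "x = vs ! i \<or> x = vs ! (Suc i mod m)"
      unfolding vs(4) by auto
    then have "Suc i mod m < m" by simp
    with i show "x \<in> verts C" using vs(1,3) nth_mem by metis
  qed
  have from0: "connected_in C (vs ! 0) (vs ! i)" if "i < m" for i
    using that
  proof (induction i)
    case 0
    show ?case by (simp add: connected_in_def)
  next
    case (Suc i)
    then have "{vs ! i, vs ! Suc i} \<in> edges C"
      unfolding vs(4) by (intro CollectI exI[of _ i]) auto
    with Suc show ?case
      unfolding connected_in_def by (meson Suc_lessD rtranclp.rtrancl_into_rtrancl)
  qed
  have "symp (connected_in C)"
    unfolding connected_in_def
    by (rule symp_rtranclp) (auto simp: symp_def insert_commute)
  moreover have "connected_in C (vs ! 0) x" if "x \<in> verts C" for x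
    using that from0 vs by (auto simp: in_set_conv_nth)
  ultimately have "connected_in C x y" if "x \<in> verts C" "y \<in> verts C" for x y
    using that unfolding connected_in_def by (meson rtranclp_trans sympD)
  then have "induced_subgraph C {y \<in> verts C. connected_in C x y} = C" if "x \<in> verts C" for x
    using that sub unfolding induced_subgraph_def by (intro graph.equality) auto
  moreover have "vs ! 0 \<in> verts C"
    using vs by (auto intro!: nth_mem)
  ultimately show ?thesis
    unfolding components_def by (auto intro!: exI[of _ "vs ! 0"])
qed

lemma verts_KK: "verts (KK u t) = {..<u} \<times> {..<t}"
  by (simp add: KK_def tensor_product_def complete_graph_def)

lemma edges_KK:
  "edges (KK u t) = {{(x, a), (y, b)} | x a y b.
     x < u \<and> y < u \<and> x \<noteq> y \<and> a < t \<and> b < t \<and> a \<noteq> b}"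
proof -
  have "{x, y} \<in> edges (complete_graph m) \<longleftrightarrow> x < m \<and> y < m \<and> x \<noteq> y" for x y m
    by (auto simp: complete_graph_def doubleton_eq_iff)
  then show ?thesis
    unfolding KK_def tensor_product_def by simp
qed

text \<open>Interface to the construction: each factor will be one closed injective walk, so only
  its image and its adjacencies have to be checked.\<close>

lemma partial_cycle_factor_walk_cycle:
  assumes "m \<ge> 3" "inj_on f {..<m}" "f m = f 0" "i < u"
    and img: "f ` {..<m} = ({..<u} - {i}) \<times> {..<t}"
    and adj: "\<And>l. l < m \<Longrightarrow> fst (f l) \<noteq> fst (f (Suc l)) \<and> snd (f l) \<noteq> snd (f (Suc l))"
  shows "partial_cycle_factor m u t (walk_cycle m f)"
proof -
  let ?F = "walk_cycle m f" and ?V = "({..<u} - {i}) \<times> {..<t}"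
  have mem: "f l \<in> ?V" "f (Suc l) \<in> ?V" if "l < m" for l
  proof -
    show "f l \<in> ?V" using that img by blast
    show "f (Suc l) \<in> ?V"
    proof (cases "Suc l = m")
      case True
      then have "f (Suc l) = f 0" using assms(3) by simp
      moreover have "f 0 \<in> f ` {..<m}" using \<open>m \<ge> 3\<close> by simp
      ultimately show ?thesis unfolding img by simp
    next
      case False
      then show ?thesis using that img by (metis Suc_lessI imageI lessThan_iff)
    qed
  qed
  have KK: "{f l, f (Suc l)} \<in> edges (KK u t)" if "l < m" for l
    using mem[OF that] adj[OF that] unfolding edges_KK
    by (intro CollectI exI[of _ "fst (f l)"] exI[of _ "snd (f l)"]
        exI[of _ "fst (f (Suc l))"] exI[of _ "snd (f (Suc l))"]) (auto simp: mem_Times_iff)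
  have part: "verts (KK u t) - part t i = ?V"
    by (auto simp: verts_KK part_def complete_graph_def)
  have "simple_graph ?F"
    unfolding simple_graph_def
  proof
    fix e assume "e \<in> edges ?F"
    then obtain l where l: "l < m" "e = {f l, f (Suc l)}"
      by (auto simp: walk_cycle_def)
    have "f l \<in> verts ?F" "f (Suc l) \<in> verts ?F"
      using mem[OF l(1)] img by (simp_all add: walk_cycle_def)
    moreover have "f l \<noteq> f (Suc l)" using adj[OF l(1)] by auto
    ultimately show "\<exists>x y. x \<in> verts ?F \<and> y \<in> verts ?F \<and> x \<noteq> y \<and> e = {x, y}"
      using l(2) by blast
  qed
  moreover have "verts ?F = verts (delete_verts (KK u t) (part t i))"
    unfolding delete_verts_def induced_subgraph_def part
    using img by (auto simp: walk_cycle_def verts_KK)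
  moreover have "edges ?F \<subseteq> edges (delete_verts (KK u t) (part t i))"
    unfolding delete_verts_def induced_subgraph_def part
  proof
    fix e assume "e \<in> edges ?F"
    then obtain l where l: "l < m" "e = {f l, f (Suc l)}"
      by (auto simp: walk_cycle_def)
    then show "e \<in> edges \<lparr>verts = verts (KK u t) \<inter> ?V, edges = {e \<in> edges (KK u t). e \<subseteq> ?V}\<rparr>"
      using KK[OF l(1)] mem[OF l(1)] by simp
  qed
  ultimately have "spanning_subgraph ?F (delete_verts (KK u t) (part t i))"
    by (simp add: spanning_subgraph_def subgraph_def)
  then show ?thesis
    using cycle_graph_walk_cycle[OF assms(1-3)] \<open>i < u\<close>
    unfolding partial_cycle_factor_def
    by (auto simp: components_cycle_graph complete_graph_def)
qed

section \<open>The base cycle\<close>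

lemma int_dvd_small_eq_0:
  fixes x n :: int
  assumes "n dvd x" "\<bar>x\<bar> < n"
  shows "x = 0"
  using assms dvd_imp_le_int[of x n] by auto

text \<open>Vertices and steps are known only up to sign; flipping signs preserves the pair of
  alternatives \<open>x - y\<close>, \<open>x + y\<close> up to sign.\<close>

lemma dvd_signed_diff:
  fixes n x y :: int
  assumes "x' = x \<or> x' = - x" "y' = y \<or> y' = - y" "n dvd x' - y'"
  shows "n dvd x - y \<or> n dvd x + y"
  using assms dvd_minus_iff[of n "x + y"] dvd_minus_iff[of n "x - y"] by auto

lemma dvd_signed_add:
  fixes n x y :: int
  assumes "x' = x \<or> x' = - x" "y' = y \<or> y' = - y" "n dvd x' + y'"
  shows "n dvd x - y \<or> n dvd x + y"
  using dvd_signed_diff[of x' x "- y'" y n] assms by auto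

locale base_cycle =
  fixes r t :: nat
  assumes r2: "r \<ge> 2" and t3: "t \<ge> 3" and odd_t: "odd t"
begin

definition n :: int where "n = 2 * int r + 1"

text \<open>Up to sign, 1, 3, ..., 2r - 1 represent each nonzero residue modulo \<open>n\<close>
  once. Alternating signs turn differences of neighbours into sums. The sign change halfway makes
  room for the closing step, which for r > 2 would otherwise repeat another step up to sign modulo
  \<open>n\<close>.\<close>

definition base :: "nat \<Rightarrow> int" where
  "base i = (- 1) ^ i * (if 2 * i + 1 < r then 1 else - 1) * (2 * int i + 1)"

definition half_sign :: "nat \<Rightarrow> int" where "half_sign l = (if even (l div r) then 1 else - 1)"

definition vertex :: "nat \<Rightarrow> int" where "vertex l = half_sign l * base (l mod r)"

text \<open>The second half of the cycle is the negated first half, so the vertex after position r -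
  1 is \<open>- base 0\<close>.\<close>

definition step :: "nat \<Rightarrow> int" where
  "step p = (if Suc p = r then - base 0 - base p else base (Suc p) - base p)"

text \<open>
  Up to sign the steps are \<open>4, 8, 12, \<dots>, 4 (r - 1)\<close>, except that the sign change in \<open>base\<close> at
  \<open>2 * i + 1 \<ge> r\<close> turns the step \<open>4 (r div 2)\<close> into 2; the closing step
  is again \<open>\<plusminus>4 (r div 2)\<close>.
\<close>

definition half_step :: "nat \<Rightarrow> int" where
  "half_step p = (if Suc p = r then 2 * int (r div 2) else if Suc p = r div 2 then 1 else 2 * int (Suc p))"

lemma half_sign_cases: "half_sign l = 1 \<or> half_sign l = - 1"
  by (simp add: half_sign_def)

lemma n_dvd_double: "n dvd 2 * x \<longleftrightarrow> n dvd x"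
proof -
  have "coprime n 2" by (simp add: n_def)
  then show ?thesis by (simp add: coprime_dvd_mult_right_iff)
qed

lemma base_cases: "base i = 2 * int i + 1 \<or> base i = - (2 * int i + 1)"
  by (cases "even i") (auto simp: base_def)

lemma step_cases:
  assumes "p < r"
  shows "step p = 2 * half_step p \<or> step p = - (2 * half_step p)"
proof (cases "Suc p = r")
  case True
  then have "base p = - ((- 1) ^ p) * (2 * int p + 1)" "base 0 = 1"
    using r2 by (auto simp: base_def)
  then have "step p = (- 1) ^ p * (2 * int p + 1) - 1"
    using True by (simp add: step_def)
  \<comment> \<open>The closing step is 2p or -(2p + 2) by the parity of \<open>p\<close>, that is,
    plus or minus twice the largest even number up to \<open>r\<close>.\<close>
  moreover have "r div 2 * 2 = (if even p then p else Suc p)"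
    using True by presburger
  then have "half_step p = (if even p then int p else int p + 1)"
    using True by (simp add: half_step_def split: if_splits)
  ultimately show ?thesis by simp
next
  case False
  then have lt: "Suc p < r" using assms by simp
  show ?thesis
  proof (cases "Suc p = r div 2")
    case True
    \<comment> \<open>The sign change falls between \<open>p\<close> and \<open>Suc p\<close> and
      cancels the alternation, so the two odd numbers are subtracted.\<close>
    then have "2 * p + 1 < r" "\<not> 2 * Suc p + 1 < r" by presburger+
    then have "step p = (- 1) ^ p * 2"
      using lt unfolding step_def base_def by (simp add: algebra_simps)
    moreover have "half_step p = 1" using True lt by (simp add: half_step_def)
    ultimately show ?thesis by (cases "even p") simp_all
  next
    case False
    \<comment> \<open>Both indices lie on the same side of the sign change, so the signs alternate
      and the absolute values add up to \<open>4 * Suc p\<close>.\<close>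
    then have "2 * p + 1 < r \<longleftrightarrow> 2 * Suc p + 1 < r"
      using lt by presburger
    then show ?thesis
      using False lt by (cases "even p") (auto simp: step_def half_step_def base_def)
  qed
qed

text \<open>Halving modulo the odd \<open>n\<close> leaves \<open>i - j\<close> or
  \<open>i + j + 1\<close>, both below \<open>n\<close> in absolute value, and the latter is
  positive.\<close>

lemma base_eq_up_to_sign:
  assumes "i < r" "j < r" "n dvd base i - base j \<or> n dvd base i + base j"
  shows "i = j"
proof -
  have "n dvd 2 * (int i - int j) \<or> n dvd 2 * (int i + int j + 1)"
    using dvd_signed_diff[OF base_cases base_cases] dvd_signed_add[OF base_cases base_cases] assms(3)
    by (force simp: algebra_simps)
  then have "n dvd int i - int j \<or> n dvd int i + int j + 1"
    by (simp only: n_dvd_double)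
  then have "int i - int j = 0 \<or> int i + int j + 1 = 0"
    using assms(1,2) int_dvd_small_eq_0[of n "int i - int j"]
      int_dvd_small_eq_0[of n "int i + int j + 1"] by (auto simp: n_def)
  then show ?thesis by auto
qed

lemma not_n_dvd_base: "i < r \<Longrightarrow> \<not> n dvd base i"
  using int_dvd_small_eq_0[of n "base i"] base_cases[of i] by (auto simp: n_def)

lemma half_step_bounds: "p < r \<Longrightarrow> 1 \<le> half_step p \<and> half_step p < n"
  using r2 by (auto simp: half_step_def n_def)

text \<open>The even value given up at \<open>Suc p = r div 2\<close> is exactly the one taken by
  the closing step, and 1 is the only odd value.\<close>

lemma half_step_inj: "\<lbrakk>p < r; q < r; half_step p = half_step q\<rbrakk> \<Longrightarrow> p = q"
  using r2 by (auto simp: half_step_def split: if_splits; presburger)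

text \<open>If both half steps are even, half their sum is positive and below \<open>n\<close>;
  otherwise the sum itself is at most 2r - 1.\<close>

lemma not_n_dvd_half_step_plus_half_step:
  assumes "p < r" "q < r"
  shows "\<not> n dvd half_step p + half_step q"
proof
  assume dvd: "n dvd half_step p + half_step q"
  have "\<exists>x. 1 \<le> x \<and> x < int r \<and> half_step i = 2 * x \<or> half_step i = 1" if "i < r" for i
    using that r2 by (cases "Suc i = r") (auto simp: half_step_def intro: exI[of _ "int (r div 2)"] exI[of _ "int (Suc i)"])
  then obtain x y where
      x: "1 \<le> x \<and> x < int r \<and> half_step p = 2 * x \<or> half_step p = 1" and
      y: "1 \<le> y \<and> y < int r \<and> half_step q = 2 * y \<or> half_step q = 1"
    using assms by meson
  have "n dvd x + y" if "half_step p = 2 * x" "half_step q = 2 * y"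
    using dvd that n_dvd_double[of "x + y"] by simp
  then show False
    using x y r2 dvd int_dvd_small_eq_0[of n "x + y"] int_dvd_small_eq_0[of n "half_step p + half_step q"]
    by (auto simp: n_def)
qed

lemma step_eq_up_to_sign:
  assumes "p < r" "q < r" "n dvd step p - step q \<or> n dvd step p + step q"
  shows "p = q"
proof -
  have "n dvd 2 * (half_step p - half_step q) \<or> n dvd 2 * (half_step p + half_step q)"
    using dvd_signed_diff[OF step_cases[OF assms(1)] step_cases[OF assms(2)]]
      dvd_signed_add[OF step_cases[OF assms(1)] step_cases[OF assms(2)]] assms(3)
    by (auto simp: algebra_simps)
  then have "n dvd half_step p - half_step q"
    using not_n_dvd_half_step_plus_half_step[OF assms(1,2)] by (simp only: n_dvd_double) simp
  then have "half_step p - half_step q = 0"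
    using half_step_bounds[OF assms(1)] half_step_bounds[OF assms(2)] by (intro int_dvd_small_eq_0) auto
  then show ?thesis
    using half_step_inj assms by simp
qed

lemma not_n_dvd_step: "p < r \<Longrightarrow> \<not> n dvd step p"
  using step_cases[of p] n_dvd_double[of "half_step p"] int_dvd_small_eq_0[of n "half_step p"] half_step_bounds[of p]
  by auto

lemma r_pos: "r > 0" using r2 by simp

lemma mod_r_less [simp]: "l mod r < r" using r_pos by simp

lemma div_add_r [simp]: "(l + r) div r = Suc (l div r)"
  using r_pos div_add_self2[of r l] by simp

lemma vertex_Suc: "vertex (Suc l) - vertex l = half_sign l * step (l mod r)"
  using r_pos by (auto simp: vertex_def step_def half_sign_def mod_Suc div_Suc)

lemma n_dvd_half_sign: "n dvd half_sign l * x \<longleftrightarrow> n dvd x"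
  using half_sign_cases[of l] by auto

lemma not_n_dvd_vertex: "\<not> n dvd vertex l"
  by (simp add: vertex_def n_dvd_half_sign not_n_dvd_base)

lemma not_n_dvd_vertex_diff: "\<not> n dvd vertex (Suc l) - vertex l"
  by (simp add: vertex_Suc n_dvd_half_sign not_n_dvd_step)

text \<open>Used for \<open>base\<close> and for \<open>step\<close>: values distinct up to sign and
  nonzero modulo \<open>n\<close> stay distinct once both signs are attached, since differing signs
  would make \<open>n\<close> divide twice a value.\<close>

lemma signed_eq:
  assumes "\<And>p q. \<lbrakk>p < r; q < r; n dvd f p - f q \<or> n dvd f p + f q\<rbrakk> \<Longrightarrow> p = q"
    and "\<And>p. p < r \<Longrightarrow> \<not> n dvd f p"
    and "n dvd half_sign l * f (l mod r) - half_sign m * f (m mod r)"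
  shows "l mod r = m mod r \<and> half_sign l = half_sign m"
proof -
  have "n dvd f (l mod r) - f (m mod r) \<or> n dvd f (l mod r) + f (m mod r)"
    by (rule dvd_signed_diff[OF _ _ assms(3)]) (use half_sign_cases in force)+
  then have eq: "l mod r = m mod r" using assms(1) by simp
  have "half_sign l = half_sign m"
  proof (rule ccontr)
    assume "half_sign l \<noteq> half_sign m"
    then have "n dvd half_sign l * (2 * f (m mod r))"
      using assms(3) eq half_sign_cases[of l] half_sign_cases[of m] by auto
    then have "n dvd 2 * f (m mod r)"
      by (simp only: n_dvd_half_sign)
    then show False using assms(2) by (simp add: n_dvd_double)
  qed
  with eq show ?thesis by simp
qed

lemma vertex_eq: "n dvd vertex l - vertex m \<Longrightarrow> l mod r = m mod r \<and> half_sign l = half_sign m"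
  unfolding vertex_def by (rule signed_eq[of base]) (auto dest: base_eq_up_to_sign simp: not_n_dvd_base)

lemma half_sign_step_eq: "n dvd half_sign l * step (l mod r) - half_sign m * step (m mod r) \<Longrightarrow> l mod r = m mod r \<and> half_sign l = half_sign m"
  by (rule signed_eq[of step]) (auto dest: step_eq_up_to_sign simp: not_n_dvd_step)

section \<open>Lifting the base cycle\<close>

text \<open>Plain alternation would sum to 0 for even \<open>r\<close>; a final sign 1 makes the
  total 1 or 2.\<close>

definition lift_sign :: "nat \<Rightarrow> int" where "lift_sign p = (if even p \<or> Suc p = r then 1 else - 1)"

definition shift :: "int \<Rightarrow> nat \<Rightarrow> int" where
  "shift e l = lift_sign (l mod r) * (if even (l div r) then e else 1 - e)"

definition level :: "int \<Rightarrow> nat \<Rightarrow> int" where "level e l = (\<Sum>q<l. shift e q)"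

definition winding :: int where "winding = (\<Sum>p<r. lift_sign p)"

definition labels :: "int set" where "labels = {e. even e \<and> 0 < e \<and> e < int t}"

definition walk :: "int \<Rightarrow> int \<Rightarrow> nat \<Rightarrow> nat \<times> nat" where
  "walk i e l = (nat ((vertex l + i) mod n), nat (level e l mod int t))"

lemma winding_cases: "winding = 1 \<or> winding = 2"
proof -
  have alt: "(\<Sum>p<m. if even p then 1 else - 1 :: int) = (if even m then 0 else 1)" for m :: nat
    by (induction m) auto
  obtain m where m: "r = Suc m" using r_pos by (cases r) auto
  have "lift_sign p = (if even p then 1 else - 1)" if "p < m" for p
    unfolding lift_sign_def using that m by auto
  then have "(\<Sum>p<m. lift_sign p) = (\<Sum>p<m. if even p then 1 else - 1)"
    by (intro sum.cong) auto
  moreover have "lift_sign m = 1" unfolding lift_sign_def using m by auto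
  moreover have "{..<r} = {..<Suc m}" using m by simp
  ultimately have "winding = (if even m then 0 else 1) + 1"
    by (simp only: winding_def alt sum.lessThan_Suc)
  then show ?thesis by auto
qed

lemma coprime_t_winding: "coprime (int t) winding"
  using winding_cases odd_t by auto

lemma lift_sign_cases: "lift_sign p = 1 \<or> lift_sign p = - 1"
  by (simp add: lift_sign_def)

text \<open>Antipodal shifts add up to a sign free of \<open>e\<close>, so all lifts have the same
  total shift per turn.\<close>

lemma shift_add_r: "shift e (l + r) = lift_sign (l mod r) - shift e l"
  using r_pos by (simp add: shift_def algebra_simps)

lemma shift_cong: "\<lbrakk>l mod r = m mod r; half_sign l = half_sign m\<rbrakk> \<Longrightarrow> shift e l = shift e m"
  by (auto simp: shift_def half_sign_def split: if_splits)

lemma half_sign_add_r: "half_sign (l + r) = - half_sign l"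
  using r_pos by (simp add: half_sign_def)

lemma vertex_cong: "\<lbrakk>l mod r = m mod r; half_sign l = half_sign m\<rbrakk> \<Longrightarrow> vertex l = vertex m"
  by (simp add: vertex_def)

lemma level_Suc: "level e (Suc l) = level e l + shift e l"
  by (simp add: level_def)

lemma level_add_period: "level e (l + 2 * r) = level e l + winding"
proof (induction l)
  case 0
  have split: "level e (r + m) = level e r + (\<Sum>q<m. shift e (q + r))" for m
    by (induction m) (simp_all add: level_def add.commute)
  \<comment> \<open>Each position of the first half turn is paired with its antipode.\<close>
  have "level e r + (\<Sum>q<r. shift e (q + r)) = winding"
    unfolding level_def winding_def sum.distrib[symmetric] by (intro sum.cong) (simp_all add: shift_add_r)
  then show ?case
    using split[of r] by (simp add: level_def mult_2)
next
  case (Suc l)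
  have "shift e (l + r + r) = shift e l" by (simp add: shift_add_r)
  then have "shift e (l + 2 * r) = shift e l" by (simp add: mult_2 add.assoc)
  with Suc show ?case by (simp add: level_Suc)
qed

lemma level_add_periods: "level e (l + q * (2 * r)) = level e l + int q * winding"
proof (induction q)
  case (Suc q)
  have "level e (l + Suc q * (2 * r)) = level e (l + q * (2 * r) + 2 * r)"
    by (simp add: algebra_simps)
  then show ?case
    using Suc level_add_period[of e "l + q * (2 * r)"] by (simp add: distrib_right)
qed simp

lemma n_pos: "n > 0" by (simp add: n_def)

section \<open>Injectivity, closure and image of the walks\<close>

lemma walk_eq_iff:
  "walk i e l = walk i' e' l' \<longleftrightarrow>
     n dvd (vertex l + i) - (vertex l' + i') \<and> int t dvd level e l - level e' l'"
  using n_pos t3 by (simp add: walk_def mod_eq_dvd_iff eq_nat_nat_iff)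

lemma walk_eq_pair_iff:
  assumes "int x < n" "a < t"
  shows "walk i e l = (x, a) \<longleftrightarrow> n dvd (vertex l + i) - int x \<and> int t dvd level e l - int a"
proof -
  have "walk i e l = (x, a) \<longleftrightarrow> (vertex l + i) mod n = int x mod n \<and> level e l mod int t = int a mod int t"
    using assms n_pos t3 by (auto simp: walk_def nat_eq_iff)
  then show ?thesis by (simp add: mod_eq_dvd_iff)
qed

text \<open>Equal first coordinates leave a whole number \<open>q\<close> of turns, which raise the
  level by \<open>q * winding\<close>; coprimality then gives \<open>t\<close> dividing
  \<open>q\<close>.\<close>

lemma walk_eq_imp_dvd:
  assumes "walk i e l = walk i e m" "l \<le> m"
  shows "2 * r * t dvd m - l"
proof -
  have vertex: "n dvd vertex l - vertex m" and level: "int t dvd level e l - level e m"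
    using assms(1) by (simp_all add: walk_eq_iff)
  have mod: "l mod r = m mod r" and "half_sign l = half_sign m" using vertex_eq[OF vertex] by auto
  \<comment> \<open>Each half turn flips the half sign, so equal signs mean an even number of half
    turns.\<close>
  then have "even (m div r - l div r)"
    using div_le_mono[OF assms(2), of r] by (auto simp: half_sign_def split: if_splits)
  then obtain q where "m div r = l div r + 2 * q"
    using div_le_mono[OF assms(2), of r] by (metis evenE le_add_diff_inverse)
  then have "r * (m div r) + m mod r = r * (l div r) + l mod r + q * (2 * r)"
    using mod by (simp add: algebra_simps)
  then have m: "m = l + q * (2 * r)" by simp
  then have "int t dvd int q * winding" using level by (simp add: level_add_periods)
  then have "t dvd q" using coprime_t_winding by (simp add: coprime_dvd_mult_left_iff)
  then show ?thesis by (simp add: m mult.commute)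
qed

lemma inj_on_walk: "inj_on (walk i e) {..<2 * r * t}"
proof (rule linorder_inj_onI')
  fix l m assume "m \<in> {..<2 * r * t}" "l < m"
  then show "walk i e l \<noteq> walk i e m"
    using walk_eq_imp_dvd[of i e l m] by (auto dest!: dvd_imp_le)
qed

lemma walk_closed: "walk i e (2 * r * t) = walk i e 0"
proof -
  have "level e (2 * r * t) - level e 0 = int t * winding"
    using level_add_periods[of e 0 t] by (simp add: mult.commute)
  moreover have "vertex (2 * r * t) = vertex 0"
  proof (rule vertex_cong)
    have "2 * r * t = 2 * t * r" by simp
    then show "2 * r * t mod r = 0 mod r" "half_sign (2 * r * t) = half_sign 0"
      using r_pos by (simp_all only: half_sign_def) simp_all
  qed
  ultimately show ?thesis by (simp add: walk_eq_iff)
qed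

text \<open>Up to sign the shift is \<open>e\<close> or \<open>e - 1\<close>, and an even positive
  \<open>e\<close> below \<open>t\<close> keeps both strictly between 0 and
  \<open>t\<close>.\<close>

lemma not_t_dvd_shift:
  assumes "e \<in> labels"
  shows "\<not> int t dvd shift e l"
proof
  assume "int t dvd shift e l"
  then have "shift e l = 0"
    using assms lift_sign_cases[of "l mod r"]
    by (intro int_dvd_small_eq_0) (auto simp: shift_def labels_def)
  then show False
    using assms lift_sign_cases[of "l mod r"] by (auto simp: shift_def labels_def split: if_splits)
qed

lemma walk_adjacent:
  assumes "e \<in> labels"
  shows "fst (walk i e l) \<noteq> fst (walk i e (Suc l)) \<and> snd (walk i e l) \<noteq> snd (walk i e (Suc l))"
proof -
  have "(vertex l + i) mod n \<noteq> (vertex (Suc l) + i) mod n"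
    using not_n_dvd_vertex_diff[of l] by (simp add: mod_eq_dvd_iff dvd_diff_commute)
  moreover have "level e l mod int t \<noteq> level e (Suc l) mod int t"
    using not_t_dvd_shift[OF assms, of l] by (simp add: mod_eq_dvd_iff level_Suc)
  ultimately show ?thesis
    using n_pos t3 by (simp add: walk_def eq_nat_nat_iff)
qed

text \<open>No vertex of the cycle is 0 modulo \<open>n\<close>, so its translate by
  \<open>i\<close> avoids part \<open>i\<close>; by injectivity both sides have
  \<open>2 * r * t\<close> elements.\<close>

lemma walk_image:
  assumes "i < 2 * r + 1"
  shows "walk (int i) e ` {..<2 * r * t} = ({..<2 * r + 1} - {i}) \<times> {..<t}"
proof (rule card_subset_eq)
  have "nat ((vertex l + int i) mod n) \<noteq> i" for l
  proof
    assume "nat ((vertex l + int i) mod n) = i"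
    then have "(vertex l + int i) mod n = int i mod n"
      using pos_mod_sign[OF n_pos, of "vertex l + int i"] assms by (simp add: n_def nat_eq_iff)
    then show False using not_n_dvd_vertex[of l] by (simp add: mod_eq_dvd_iff)
  qed
  moreover have "nat ((vertex l + int i) mod n) < 2 * r + 1" for l
    using pos_mod_bound[OF n_pos, of "vertex l + int i"] pos_mod_sign[OF n_pos, of "vertex l + int i"]
    by (simp add: n_def nat_less_iff)
  ultimately show "walk (int i) e ` {..<2 * r * t} \<subseteq> ({..<2 * r + 1} - {i}) \<times> {..<t}"
    using t3 by (auto simp: walk_def nat_less_iff)
  show "card (walk (int i) e ` {..<2 * r * t}) = card (({..<2 * r + 1} - {i}) \<times> {..<t})"
    using assms by (simp add: card_image[OF inj_on_walk] card_cartesian_product)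
qed simp

section \<open>Every edge lies on a walk\<close>

text \<open>By counting: the 2r signed steps are distinct nonzero residues modulo \<open>n\<close>,
  hence all of them.\<close>

lemma step_covers:
  assumes "\<not> n dvd \<delta>"
  shows "\<exists>p<r. n dvd step p - \<delta> \<or> n dvd step p + \<delta>"
proof -
  let ?h = "\<lambda>l. (half_sign l * step (l mod r)) mod n"
  have "inj_on ?h {..<2 * r}"
  proof (rule inj_onI)
    fix l m assume lm: "l \<in> {..<2 * r}" "m \<in> {..<2 * r}" "?h l = ?h m"
    then have eq: "l mod r = m mod r" "half_sign l = half_sign m"
      using half_sign_step_eq by (auto simp: mod_eq_dvd_iff)
    have "l div r < 2" "m div r < 2"
      using lm r_pos by (auto simp: less_mult_imp_div_less)
    then have "l div r = m div r"
      using eq(2) by (auto simp: half_sign_def less_2_cases_iff split: if_splits)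
    with eq(1) show "l = m" by (metis div_mult_mod_eq)
  qed
  then have "card (?h ` {..<2 * r}) = 2 * r" by (simp add: card_image)
  moreover have "?h ` {..<2 * r} \<subseteq> {1..<n}"
  proof
    fix x assume "x \<in> ?h ` {..<2 * r}"
    then obtain l where x: "x = ?h l" by auto
    have "?h l \<noteq> 0" using not_n_dvd_step[of "l mod r"] by (simp add: mod_eq_0_iff_dvd n_dvd_half_sign)
    then show "x \<in> {1..<n}"
      using pos_mod_bound[OF n_pos, of "half_sign l * step (l mod r)"]
        pos_mod_sign[OF n_pos, of "half_sign l * step (l mod r)"] unfolding x atLeastLessThan_iff by linarith
  qed
  ultimately have "?h ` {..<2 * r} = {1..<n}"
    by (intro card_subset_eq) (auto simp: n_def)
  moreover have "\<delta> mod n \<in> {1..<n}"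
    using assms pos_mod_bound[OF n_pos, of \<delta>] pos_mod_sign[OF n_pos, of \<delta>]
    by (auto simp: mod_eq_0_iff_dvd[symmetric])
  ultimately have "\<delta> mod n \<in> ?h ` {..<2 * r}" by simp
  then obtain l where "\<delta> mod n = ?h l" by (elim imageE)
  then have "?h l = \<delta> mod n" by (rule sym)
  then have "n dvd half_sign l * step (l mod r) - \<delta>" by (simp add: mod_eq_dvd_iff)
  then have "n dvd step (l mod r) - \<delta> \<or> n dvd step (l mod r) + \<delta>"
    using half_sign_cases[of l] by (intro dvd_signed_diff[of "half_sign l * step (l mod r)" _ \<delta>]) auto
  then show ?thesis by (intro exI[of _ "l mod r"]) simp
qed

text \<open>Translate the cycle so that \<open>vertex p\<close> lands on \<open>x\<close>. By
  \<open>walk_image\<close> that walk visits \<open>(x, a)\<close>, possibly in another turn than at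
  \<open>p\<close>, but at the same cycle position, so it continues with the step and shift of
  \<open>p\<close>.\<close>

lemma walk_through_arc:
  assumes "int x < n" "int y < n" "a < t" "b < t"
    and step: "n dvd half_sign p * step (p mod r) - (int y - int x)"
    and shift: "int t dvd shift e p - (int b - int a)"
  shows "\<exists>i<2 * r + 1. \<exists>l<2 * r * t. {walk (int i) e l, walk (int i) e (Suc l)} = {(x, a), (y, b)}"
proof -
  define i where "i = nat ((int x - vertex p) mod n)"
  have i: "int i = (int x - vertex p) mod n" using n_pos by (simp add: i_def)
  then have less: "i < 2 * r + 1"
    using pos_mod_bound[OF n_pos, of "int x - vertex p"] by (simp add: n_def)
  have "n dvd int i - (int x - vertex p)"
    unfolding i by (metis mod_eq_dvd_iff mod_mod_trivial)
  then have ix: "n dvd vertex p + int i - int x" by (simp add: algebra_simps)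
  have "x \<noteq> i" using ix not_n_dvd_vertex[of p] by auto
  then have "(x, a) \<in> walk (int i) e ` {..<2 * r * t}"
    unfolding walk_image[OF less] using assms(1,3) by (simp add: n_def)
  then obtain l where l: "l < 2 * r * t" "walk (int i) e l = (x, a)" by force
  then have Vl: "n dvd vertex l + int i - int x" and Al: "int t dvd level e l - int a"
    using walk_eq_pair_iff assms by auto
  have "n dvd vertex l - vertex p" using dvd_diff[OF Vl ix] by simp
  then have eq: "l mod r = p mod r" "half_sign l = half_sign p" using vertex_eq by auto
  have "n dvd (vertex l + int i - int x) + (half_sign l * step (l mod r) - (int y - int x))"
    using Vl step eq by (intro dvd_add) simp_all
  then have "n dvd vertex (Suc l) + int i - int y"
    unfolding vertex_Suc[symmetric] by (simp add: algebra_simps)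
  moreover have "int t dvd (level e l - int a) + (shift e l - (int b - int a))"
    using Al shift shift_cong[OF eq] by (intro dvd_add) simp_all
  then have "int t dvd level e (Suc l) - int b"
    by (simp add: level_Suc algebra_simps)
  ultimately have "walk (int i) e (Suc l) = (y, b)"
    using walk_eq_pair_iff assms by auto
  then have "{walk (int i) e l, walk (int i) e (Suc l)} = {(x, a), (y, b)}"
    using l by simp
  then show ?thesis using l(1) less by blast
qed

lemma walks_cover_edge:
  assumes "int x < n" "int y < n" "a < t" "b < t" "a \<noteq> b" "p < r"
    and step: "n dvd step p - (int y - int x)"
  shows "\<exists>e\<in>labels. \<exists>i<2 * r + 1. \<exists>l<2 * r * t.
    {walk (int i) e l, walk (int i) e (Suc l)} = {(x, a), (y, b)}"
proof -
  \<comment> \<open>The second difference along the arc, freed from the lift sign and reduced modulo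
    \<open>t\<close>; its parity decides which of two antipodal arcs carries the edge.\<close>
  define c where "c = (lift_sign p * (int b - int a)) mod int t"
  have p: "p mod r = p" "(p + r) mod r = p" "half_sign p = 1" "half_sign (p + r) = - 1"
      "shift e p = lift_sign p * e" "shift e (p + r) = lift_sign p * (1 - e)" for e
    using \<open>p < r\<close> by (simp_all add: half_sign_def shift_def)
  have "int t dvd c - lift_sign p * (int b - int a)"
    unfolding c_def by (metis mod_eq_dvd_iff mod_mod_trivial)
  then have "int t dvd lift_sign p * (c - lift_sign p * (int b - int a))" by simp
  then have c: "int t dvd lift_sign p * c - (int b - int a)"
    using lift_sign_cases[of p] by (auto simp: algebra_simps)
  have "c \<noteq> 0"
  proof
    assume "c = 0"
    then have "int t dvd int b - int a"
      using c by (simp add: dvd_diff_commute)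
    then have "int b - int a = 0"
      using assms by (intro int_dvd_small_eq_0) auto
    then show False using \<open>a \<noteq> b\<close> by simp
  qed
  moreover have "0 \<le> c" "c < int t" using t3 by (auto simp: c_def)
  ultimately have bounds: "0 < c" "c < int t" by auto
  show ?thesis
  proof (cases "even c")
    case True
    then have "c \<in> labels" using bounds by (simp add: labels_def)
    then show ?thesis
      using walk_through_arc[of x y a b p c] assms c by (auto simp: p)
  next
    case False
    \<comment> \<open>Label \<open>c + 1\<close> gives the antipodal arc the shift
      \<open>- lift_sign p * c\<close>, so it traverses the edge from \<open>(y, b)\<close> to
      \<open>(x, a)\<close>. As \<open>t\<close> is odd, the even number \<open>c + 1\<close> stays
      below \<open>t\<close>.\<close>
    then have "even (c + 1)" by simp
    then have "c + 1 \<noteq> int t" using odd_t by (metis even_of_nat)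
    then have "c + 1 \<in> labels" using False bounds by (simp add: labels_def)
    moreover have "int t dvd shift (c + 1) (p + r) - (int a - int b)"
      using c dvd_minus_iff[of "int t" "lift_sign p * c - (int b - int a)"] by (simp add: p algebra_simps)
    moreover have "n dvd half_sign (p + r) * step ((p + r) mod r) - (int x - int y)"
      using step dvd_minus_iff[of n "step p - (int y - int x)"]
      unfolding p by (simp add: algebra_simps)
    ultimately show ?thesis
      using walk_through_arc[of y x b a "p + r" "c + 1"] assms(1-4)
      unfolding insert_commute[of "(y, b)" "(x, a)"] by blast
  qed
qed

section \<open>No edge lies on two walks\<close>

text \<open>Traversals in the same direction sit at the same cycle position, which forces equal
  \<open>i\<close> and \<open>e\<close>. Opposite directions sit at antipodal positions, which
  parity excludes.\<close>

lemma edge_determines_walk: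
  assumes "e \<in> labels" "e' \<in> labels"
    and "i < 2 * r + 1" "i' < 2 * r + 1"
    and "{walk (int i) e l, walk (int i) e (Suc l)} = {walk (int i') e' m, walk (int i') e' (Suc m)}"
  shows "i = i' \<and> e = e'"
proof -
  consider (same) "walk (int i) e l = walk (int i') e' m"
      "walk (int i) e (Suc l) = walk (int i') e' (Suc m)"
    | (swap) "walk (int i) e l = walk (int i') e' (Suc m)"
      "walk (int i) e (Suc l) = walk (int i') e' m"
    using assms(5) by (auto simp: doubleton_eq_iff)
  then show ?thesis
  proof cases
    case same
    then have 1: "n dvd vertex l + int i - (vertex m + int i')"
        "n dvd vertex (Suc l) + int i - (vertex (Suc m) + int i')"
        "int t dvd level e l - level e' m" "int t dvd level e (Suc l) - level e' (Suc m)"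
      by (auto simp: walk_eq_iff)
    have "n dvd half_sign l * step (l mod r) - half_sign m * step (m mod r)"
      using dvd_diff[OF 1(2,1)] by (simp add: vertex_Suc[symmetric] algebra_simps)
    then have eq: "l mod r = m mod r" "half_sign l = half_sign m" using half_sign_step_eq by auto
    then have "n dvd int i - int i'" using 1(1) vertex_cong[OF eq] by simp
    then have "int i - int i' = 0"
      using assms by (intro int_dvd_small_eq_0) (auto simp: n_def)
    moreover have "int t dvd shift e l - shift e' l"
      using dvd_diff[OF 1(4,3)] shift_cong[OF eq] by (simp add: level_Suc algebra_simps)
    then have "int t dvd e - e'"
      using lift_sign_cases[of "l mod r"] by (auto simp: shift_def dvd_diff_commute split: if_splits)
    then have "e - e' = 0"
      using assms by (intro int_dvd_small_eq_0) (auto simp: labels_def)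
    ultimately show ?thesis by simp
  next
    case swap
    then have 1: "n dvd vertex l + int i - (vertex (Suc m) + int i')"
        "n dvd vertex (Suc l) + int i - (vertex m + int i')"
        "int t dvd level e l - level e' (Suc m)" "int t dvd level e (Suc l) - level e' m"
      by (auto simp: walk_eq_iff)
    \<comment> \<open>Traversing the arc at \<open>m\<close> backwards negates its step, giving the
      step at \<open>m + r\<close>.\<close>
    have "n dvd half_sign l * step (l mod r) - half_sign (m + r) * step ((m + r) mod r)"
      using dvd_diff[OF 1(2,1)] vertex_Suc[of l] vertex_Suc[of m] by (simp add: half_sign_add_r algebra_simps)
    then have eq: "l mod r = (m + r) mod r" "half_sign l = half_sign (m + r)" using half_sign_step_eq by blast+
    have "int t dvd shift e l + shift e' m"
      using dvd_diff[OF 1(4,3)] by (simp add: level_Suc algebra_simps)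
    then have "int t dvd lift_sign (m mod r) - shift e m + shift e' m"
      using shift_cong[OF eq] by (simp add: shift_add_r)
    \<comment> \<open>The two shifts cancel modulo \<open>t\<close>, but up to sign their sum is 1
      plus a difference of even labels: odd and smaller than \<open>t\<close>, so it cannot
      vanish.\<close>
    then have "int t dvd 1 - e + e' \<or> int t dvd 1 + e - e'"
      using lift_sign_cases[of "m mod r"] dvd_minus_iff[of "int t" "1 - e + e'"]
        dvd_minus_iff[of "int t" "1 + e - e'"]
      by (auto simp: shift_def algebra_simps split: if_splits)
    moreover have ev: "even e" "even e'" "e < int t" "e' < int t" "0 < e" "0 < e'"
      using assms(1,2) by (auto simp: labels_def)
    then have "2 \<le> e" "2 \<le> e'" by presburger+
    then have "\<bar>1 - e + e'\<bar> < int t" "\<bar>1 + e - e'\<bar> < int t"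
      using ev(3,4) by linarith+
    ultimately have "1 - e + e' = 0 \<or> 1 + e - e' = 0"
      using int_dvd_small_eq_0[of "int t" "1 - e + e'"]
        int_dvd_small_eq_0[of "int t" "1 + e - e'"] by blast
    then show ?thesis using ev(1,2) by presburger
  qed
qed

section \<open>The factorization\<close>

lemma partial_cycle_factorization_walks:
  "partial_cycle_factorization (2 * r * t) (2 * r + 1) t
    ((\<lambda>(i, e). walk_cycle (2 * r * t) (walk (int i) e)) ` ({..<2 * r + 1} \<times> labels))"
    (is "partial_cycle_factorization ?m ?u t ?\<F>")
proof -
  have "?m \<ge> 2 * 2 * 3" using r2 t3 by (intro mult_le_mono) auto
  then have m3: "?m \<ge> 3" by simp
  have "partial_cycle_factor ?m ?u t (walk_cycle ?m (walk (int i) e))"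
    if "i < ?u" "e \<in> labels" for i e
    using that m3 inj_on_walk walk_closed walk_image walk_adjacent
    by (intro partial_cycle_factor_walk_cycle) auto
  then have factors: "\<forall>F\<in>?\<F>. partial_cycle_factor ?m ?u t F" by auto
  have edges: "edges (walk_cycle ?m (walk (int i) e)) =
      {{walk (int i) e l, walk (int i) e (Suc l)} | l. l < ?m}" for i e
    by (simp add: walk_cycle_def)
  have "disjoint_family_on edges ?\<F>"
    unfolding disjoint_family_on_def
  proof (intro ballI impI)
    fix F G assume "F \<in> ?\<F>" "G \<in> ?\<F>" "F \<noteq> G"
    then obtain i e i' e' where FG:
        "i < ?u" "e \<in> labels" "F = walk_cycle ?m (walk (int i) e)"
        "i' < ?u" "e' \<in> labels" "G = walk_cycle ?m (walk (int i') e')"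
        "(i, e) \<noteq> (i', e')"
      by auto
    show "edges F \<inter> edges G = {}"
    proof (rule ccontr)
      assume "edges F \<inter> edges G \<noteq> {}"
      then obtain l m where
        "{walk (int i) e l, walk (int i) e (Suc l)} = {walk (int i') e' m, walk (int i') e' (Suc m)}"
        unfolding FG edges by blast
      from edge_determines_walk[OF FG(2,5,1,4) this] FG(7) show False by simp
    qed
  qed
  moreover have "(\<Union>F\<in>?\<F>. edges F) = edges (KK ?u t)"
  proof
    have "edges F \<subseteq> edges (KK ?u t)" if "partial_cycle_factor ?m ?u t F" for F
      using that by (auto simp: partial_cycle_factor_def spanning_subgraph_def subgraph_def
          delete_verts_def induced_subgraph_def)
    then show "(\<Union>F\<in>?\<F>. edges F) \<subseteq> edges (KK ?u t)"
      using factors by (metis UN_least)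
  next
    show "edges (KK ?u t) \<subseteq> (\<Union>F\<in>?\<F>. edges F)"
    proof
      fix E assume "E \<in> edges (KK ?u t)"
      then obtain x a y b where E: "E = {(x, a), (y, b)}"
          and "x < ?u" "y < ?u" and "x \<noteq> y" and ab: "a < t" "b < t" "a \<noteq> b"
        unfolding edges_KK by blast
      then have xy: "int x < n" "int y < n" "x \<noteq> y" by (simp_all add: n_def)
      have "int y - int x = 0" if "n dvd int y - int x"
        using that xy by (intro int_dvd_small_eq_0) auto
      \<comment> \<open>A step matches the difference only up to sign; in the second case the edge
        is read from \<open>y\<close> to \<open>x\<close>.\<close>
      then obtain p where p: "p < r" "n dvd step p - (int y - int x) \<or> n dvd step p - (int x - int y)"
        using step_covers[of "int y - int x"] xy(3) by (auto simp: algebra_simps)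
      then have "\<exists>e\<in>labels. \<exists>i<?u. \<exists>l<?m. {walk (int i) e l, walk (int i) e (Suc l)} = E"
        using walks_cover_edge[of x y a b p] walks_cover_edge[of y x b a p] xy ab
        unfolding E insert_commute[of "(y, b)" "(x, a)"] by blast
      then obtain e i l where "e \<in> labels" "i < ?u" "l < ?m"
          "E = {walk (int i) e l, walk (int i) e (Suc l)}" by blast
      then have "(i, e) \<in> {..<?u} \<times> labels" "E \<in> edges (walk_cycle ?m (walk (int i) e))"
        unfolding edges by auto
      then show "E \<in> (\<Union>F\<in>?\<F>. edges F)" by (intro UN_I) auto
    qed
  qed
  ultimately show ?thesis
    unfolding partial_cycle_factorization_def using factors by simp
qed

end

theorem theorem3p3:
  fixes k t :: nat
  assumes "even k" and "k \<ge> 4" and "odd t" and "t \<ge> 3"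
  shows "\<exists>\<F>. partial_cycle_factorization (k * t) (k + 1) t \<F>"
proof -
  obtain r where k: "k = 2 * r" using \<open>even k\<close> by (elim evenE)
  interpret base_cycle r t
    using assms by unfold_locales (auto simp: k)
  show ?thesis
    using partial_cycle_factorization_walks unfolding k by blast
qed

end
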